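(* Let $A\subset\mathbb{R}^2$ and suppose there is a point $y\in A$ such that $\mathcal{H}^1(A\cap B_\rho(y))=\infty$ for all $\rho>0$. Suppose further that there are $\rho_1>0$, a Lipschitz function $u:\mathbb{R}\to\mathbb{R}$, and a one-dimensional linear subspace $G$ of $\mathbb{R}^2$ with associated rotation $R_G:\mathbb{R}^2\to\mathbb{R}^2$ satisfying $R_G(G)=\mathbb{R}\times\{0\}$, such that, with $\Sigma:=R_G^{-1}(\operatorname{graph}u)$, one has $y\in \Sigma\cap B_{\rho_1}(y)$ and $$\overline{B_{\rho_1}(y)\cap A\cap \Sigma}=\overline{\Sigma\cap B_{\rho_1}(y)} .$$ Then $A$ does not have property (iv) for $j=1$.
   Context: $\mathcal{H}^1$ is one-dimensional Hausdorff measure, $B_\rho(y)$ the open ball of radius $\rho$ about $y$, and $\operatorname{graph}u=\{(x,u(x)):x\in\mathbb{R}\}$. For an affine subspace $L\subset\mathbb{R}^n$ and $s>0$, $L^{s}:=\{x\in\mathbb{R}^n:|x-z|<s\text{ for some }z\in L\}$. Property (iv) (the fine weak $j$-dimensional approximation property with local $\rho_y$-uniformity) for a set $A\subset\mathbb{R}^n$: for every $\delta>0$ and every $y\in A$ there is $\rho_y>0$ such that for all $\rho\in(0,\rho_y]$ and all $x\in B_{\rho_y}(y)$ there is a $j$-dimensional affine space $L_{x,\rho}$ with $B_\rho(x)\cap A\subset L_{x,\rho}^{\delta\rho}$. *)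

theory Defs
  imports "HOL-Analysis.Analysis"
begin

text \<open>One-dimensional Hausdorff measure, as an outer measure on arbitrary sets. The usual factor
  \<open>\<omega>\<^sub>1 / 2\<close> is \<open>1\<close>. Covering sets are required to be bounded because \<open>diameter\<close> is unspecified
  on unbounded sets; finite covers are included, since covering sets may be empty.\<close>

definition hausdorff1_pre :: "real \<Rightarrow> 'a::metric_space set \<Rightarrow> ennreal" where
  "hausdorff1_pre \<delta> A =
     (INF C \<in> {C :: nat \<Rightarrow> 'a set. A \<subseteq> (\<Union>i. C i) \<and> (\<forall>i. bounded (C i) \<and> diameter (C i) < \<delta>)}.
        \<Sum>i. ennreal (diameter (C i)))"

definition hausdorff1 :: "'a::metric_space set \<Rightarrow> ennreal" where
  "hausdorff1 A = (SUP \<delta> \<in> {0<..}. hausdorff1_pre \<delta> A)"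

definition neighbourhood :: "'a::euclidean_space set \<Rightarrow> real \<Rightarrow> 'a set" where
  "neighbourhood L s = {x. \<exists>z\<in>L. norm (x - z) < s}"

text \<open>The fine weak \<open>j\<close>-dimensional approximation property with local \<open>\<rho>\<^sub>y\<close>-uniformity. The centre
  \<open>x\<close> ranges over the whole ball about \<open>y\<close>, not only over points of \<open>A\<close>.\<close>

definition fine_weak_approx_local :: "nat \<Rightarrow> 'a::euclidean_space set \<Rightarrow> bool" where
  "fine_weak_approx_local j A \<longleftrightarrow>
     (\<forall>\<delta>>0. \<forall>y\<in>A. \<exists>\<rho>\<^sub>y>0. \<forall>\<rho>\<in>{0<..\<rho>\<^sub>y}. \<forall>x\<in>ball y \<rho>\<^sub>y.
        \<exists>L. affine L \<and> aff_dim L = int j \<and> ball x \<rho> \<inter> A \<subseteq> neighbourhood L (\<delta> * \<rho>))"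

definition graph_of :: "(real \<Rightarrow> real) \<Rightarrow> (real^2) set" where
  "graph_of u = {vector [x, u x] | x. True}"

end

theory Submission
  imports Defs
begin

text \<open>Property (iv) with a small \<open>\<delta>\<close> forces \<open>A\<close> to lie in \<open>\<Sigma>\<close> near \<open>y\<close>. Otherwise a point
  \<open>x\<close> of \<open>A\<close> near \<open>y\<close> has positive vertical distance \<open>d\<close> to the graph; at a scale comparable to \<open>d\<close> the
  approximating line must pass close to the graph points at horizontal offsets \<open>-d\<close>, \<open>0\<close> and \<open>d\<close> from \<open>x\<close>
  (they are limits of points of \<open>A\<close>), so it has bounded slope, and also close to \<open>x\<close>, so it is steep.
  But bounded pieces of a Lipschitz graph have finite \<open>\<H>\<^sup>1\<close>-measure.\<close>

section \<open>Length of Lipschitz images of intervals\<close>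

lemma hausdorff1_mono:
  assumes "A \<subseteq> B"
  shows "hausdorff1 A \<le> hausdorff1 B"
  unfolding hausdorff1_def hausdorff1_pre_def
  by (intro SUP_mono' INF_superset_mono) (use assms in auto)

text \<open>Images of \<open>N\<close> equal pieces of the interval form a cover whose diameters add
  up to at most \<open>C * (b - a)\<close>, however fine the subdivision; hence the bound survives
  the supremum over \<delta>.\<close>

lemma hausdorff1_lipschitz_image:
  fixes f :: "real \<Rightarrow> 'a::real_normed_vector"
  assumes lip: "C-lipschitz_on {a..b} f" and "a < b"
  shows "hausdorff1 (f ` {a..b}) \<le> ennreal (C * (b - a))"
  unfolding hausdorff1_def
proof (rule SUP_least)
  fix \<delta> :: real assume "\<delta> \<in> {0<..}"
  then have \<delta>: "\<delta> > 0" by simp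
  have C0: "C \<ge> 0" using lip by (rule lipschitz_on_nonneg)
  \<comment> \<open>The quotient makes the diameter bound \<open>C * h\<close> smaller than
    \<delta>; the maximum with 1 keeps \<open>N\<close> positive when \<open>C\<close> is 0.\<close>
  obtain N :: nat where N: "real N > max 1 (C * (b - a) / \<delta>)"
    using reals_Archimedean2 by blast
  define h where "h = (b - a) / N"
  have N0: "real N > 0" "N > 0" using N by auto
  have h: "h > 0" "N * h = b - a" using N0 \<open>a < b\<close> by (auto simp: h_def)
  have "C * (b - a) < \<delta> * N" using N \<delta> by (simp add: field_simps)
  then have Ch: "C * h < \<delta>" using N0 by (simp add: h_def field_simps)
  \<comment> \<open>The sequence is padded with empty sets, of diameter 0. Pieces are cut down to
    \<open>{a..b}\<close>, where the Lipschitz bound is available.\<close>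
  define D where "D i = (if i < N then f ` ({a..b} \<inter> {a + i * h .. a + (real i + 1) * h}) else {})" for i :: nat
  have dist_D: "norm (x - y) \<le> C * h" if "x \<in> D i" "y \<in> D i" for i x y
  proof -
    have "i < N" using that by (auto simp: D_def split: if_splits)
    with that obtain s t where st: "x = f s" "y = f t" "s \<in> {a..b}" "t \<in> {a..b}"
      "s \<in> {a + i * h .. a + (real i + 1) * h}" "t \<in> {a + i * h .. a + (real i + 1) * h}"
      by (auto simp: D_def)
    have "norm (x - y) \<le> C * \<bar>s - t\<bar>"
      using lipschitz_onD[OF lip st(3,4)] st(1,2) by (simp add: dist_norm)
    also have "\<bar>s - t\<bar> \<le> h" using st(5,6) by (auto simp: algebra_simps)
    then have "C * \<bar>s - t\<bar> \<le> C * h" using C0 by (rule mult_left_mono)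
    finally show ?thesis .
  qed
  have bdd: "bounded (D i)" for i
    using dist_D[of _ i] by (auto simp: bounded_two_points dist_norm)
  have diam: "diameter (D i) \<le> C * h" for i
    using dist_D[of _ i] C0 h by (intro diameter_le) auto
  have cover: "f ` {a..b} \<subseteq> (\<Union>i. D i)"
  proof
    fix p assume "p \<in> f ` {a..b}"
    then obtain t where t: "p = f t" "t \<in> {a..b}" by auto
    have "\<exists>i<N. t \<in> {a + i * h .. a + (real i + 1) * h}"
    proof (cases "t = b")
      case True
      \<comment> \<open>The floor used below would give index \<open>N\<close> at the right
        endpoint, so \<open>b\<close> is assigned to the last piece.\<close>
      then show ?thesis using N0 h True by (intro exI[of _ "N - 1"]) (auto simp: algebra_simps)
    next
      case False
      define i where "i = nat \<lfloor>(t - a) / h\<rfloor>"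
      have "(t - a) / h \<ge> 0" using t h by simp
      then have i: "real i \<le> (t - a) / h" "(t - a) / h < real i + 1"
        by (auto simp: i_def)
      then have i': "i * h \<le> t - a" "t - a < (i + 1) * h" using h by (auto simp: field_simps)
      have "i * h < N * h" using i' False t h by auto
      then have "i < N" using mult_less_cancel_right_pos[OF h(1)] by simp
      then show ?thesis using i' by (intro exI[of _ i]) (auto simp: algebra_simps)
    qed
    then obtain i where i: "i < N" "t \<in> {a + i * h .. a + (real i + 1) * h}"
      by blast
    then have "t \<in> {a..b} \<inter> {a + i * h .. a + (real i + 1) * h}" using t by blast
    then have "p \<in> D i" unfolding D_def t(1) if_P[OF i(1)] by (rule imageI)
    then show "p \<in> (\<Union>i. D i)" by blast
  qed
  have "hausdorff1_pre \<delta> (f ` {a..b}) \<le> (\<Sum>i. ennreal (diameter (D i)))"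
    unfolding hausdorff1_pre_def
    by (rule INF_lower) (use cover bdd le_less_trans[OF diam Ch] in auto)
  also have "\<dots> = (\<Sum>i<N. ennreal (diameter (D i)))"
    by (rule suminf_finite) (auto simp: D_def)
  also have "\<dots> \<le> (\<Sum>i<N. ennreal (C * h))"
    by (intro sum_mono ennreal_leI diam)
  also have "\<dots> = ennreal (N * (C * h))"
    using C0 h by (simp add: ennreal_mult ennreal_of_nat_eq_real_of_nat)
  also have "N * (C * h) = C * (b - a)" using h(2) by (simp add: ac_simps)
  finally show "hausdorff1_pre \<delta> (f ` {a..b}) \<le> ennreal (C * (b - a))" .
qed

section \<open>Points, lines and neighbourhoods in the plane\<close>

lemma vector_2_components:
  fixes z :: "real^2"
  shows "z = vector [z $ 1, z $ 2]"
  by (simp add: vec_eq_iff forall_2)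

lemma inner_real_2:
  fixes v w :: "real^2"
  shows "v \<bullet> w = v $ 1 * w $ 1 + v $ 2 * w $ 2"
  by (simp add: inner_vec_def sum_2)

lemma norm_real_2_le:
  fixes v :: "real^2"
  shows "norm v \<le> \<bar>v $ 1\<bar> + \<bar>v $ 2\<bar>"
  using norm_le_l1_cart[of v] by (simp add: sum_2)

lemma mem_graph_of: "z \<in> graph_of u \<longleftrightarrow> z $ 2 = u (z $ 1)"
proof
  assume "z $ 2 = u (z $ 1)"
  then have "z = vector [z $ 1, u (z $ 1)]" by (metis vector_2_components)
  then show "z \<in> graph_of u" by (auto simp: graph_of_def)
qed (auto simp: graph_of_def)

lemma orthogonal_transformation_norm_diff:
  "orthogonal_transformation R \<Longrightarrow> norm (R v - R w) = norm (v - w)"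
  by (metis linear_diff orthogonal_transformation_linear orthogonal_transformation_norm)

text \<open>Points of the graph are only limits of points of \<open>A\<close>. Replacing
  \<open>p\<close> by a point of \<open>A\<close> within \<open>s\<close> of it costs a factor 2 in
  the width.\<close>

lemma closure_in_neighbourhood:
  assumes "ball x \<rho> \<inter> A \<subseteq> neighbourhood L s" "p \<in> closure A" "p \<in> ball x \<rho>" "s > 0"
  shows "\<exists>z\<in>L. norm (p - z) < 2 * s"
proof -
  have "open (ball x \<rho> \<inter> ball p s)" "p \<in> ball x \<rho> \<inter> ball p s" using assms by auto
  then obtain q where q: "q \<in> A" "q \<in> ball x \<rho>" "q \<in> ball p s"
    using assms(2) unfolding closure_iff_nhds_not_empty by blast
  then obtain z where "z \<in> L" "norm (q - z) < s"
    using assms(1) by (auto simp: neighbourhood_def)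
  moreover have "norm (p - q) < s" using q by (simp add: dist_norm)
  ultimately show ?thesis
    using norm_triangle_ineq[of "p - q" "q - z"] by (intro bexI[of _ z]) auto
qed

text \<open>All four points nearly solve \<open>m \<bullet> x = c\<close>. The pair
  \<open>p\<close>, \<open>q0\<close> on one vertical bounds \<open>m $ 2\<close>; the pair
  \<open>q1\<close>, \<open>q2\<close>, whose chord has slope at most \<open>C\<close>, then bounds
  \<open>m $ 1\<close>. Together they bound the whole normal.\<close>

lemma vertical_gap_le:
  fixes m p q0 q1 q2 :: "real^2"
  assumes near: "\<bar>m \<bullet> p - c\<bar> \<le> \<eta>" "\<bar>m \<bullet> q0 - c\<bar> \<le> \<eta>" "\<bar>m \<bullet> q1 - c\<bar> \<le> \<eta>" "\<bar>m \<bullet> q2 - c\<bar> \<le> \<eta>"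
    and q0: "q0 $ 1 = p $ 1" "\<bar>p $ 2 - q0 $ 2\<bar> = d"
    and q12: "q2 $ 1 - q1 $ 1 = 2 * d" "\<bar>q2 $ 2 - q1 $ 2\<bar> \<le> C * (2 * d)"
    and "C \<ge> 0" "d \<ge> 0"
  shows "d * norm m \<le> (3 + 2 * C) * \<eta>"
proof -
  have "\<bar>m $ 2\<bar> * d = \<bar>m \<bullet> p - m \<bullet> q0\<bar>"
    using q0 by (simp add: inner_real_2 abs_mult flip: right_diff_distrib)
  then have v: "\<bar>m $ 2\<bar> * d \<le> 2 * \<eta>" using near by linarith
  have e: "m \<bullet> q2 - m \<bullet> q1 = m $ 1 * (2 * d) + m $ 2 * (q2 $ 2 - q1 $ 2)"
    using q12(1) by (simp add: inner_real_2 algebra_simps flip: q12(1))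
  have "\<bar>m $ 2 * (q2 $ 2 - q1 $ 2)\<bar> \<le> \<bar>m $ 2\<bar> * (C * (2 * d))"
    unfolding abs_mult using q12(2) by (intro mult_left_mono) auto
  also have "\<dots> = 2 * C * (\<bar>m $ 2\<bar> * d)" by simp
  also have "\<dots> \<le> 2 * C * (2 * \<eta>)" using v \<open>C \<ge> 0\<close> by (intro mult_left_mono) auto
  finally have "\<bar>m $ 1 * (2 * d)\<bar> \<le> 2 * \<eta> + 2 * C * (2 * \<eta>)" using e near by linarith
  then have "\<bar>m $ 1\<bar> * d \<le> \<eta> + 2 * C * \<eta>" using \<open>d \<ge> 0\<close> by (simp add: abs_mult)
  moreover have "d * norm m \<le> d * (\<bar>m $ 1\<bar> + \<bar>m $ 2\<bar>)"
    using \<open>d \<ge> 0\<close> by (intro mult_left_mono norm_real_2_le)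
  ultimately show ?thesis using v by (simp add: algebra_simps)
qed

text \<open>In the plane, dimension one is codimension one. The normal form treats vertical lines
  like all others.\<close>

lemma aff_dim_1_hyperplane:
  fixes L :: "(real^2) set"
  assumes "affine L" "aff_dim L = 1"
  obtains n c where "n \<noteq> 0" "L = {x. n \<bullet> x = c}"
proof -
  have "\<exists>n c. n \<noteq> 0 \<and> affine hull L = {x. n \<bullet> x = c}"
    using aff_dim_eq_hyperplane[of L] assms(2) by simp
  then have "\<exists>n c. n \<noteq> 0 \<and> L = {x. n \<bullet> x = c}"
    unfolding hull_same[of affine, OF assms(1)] .
  then show thesis using that by blast
qed

section \<open>Containment in the graph near \<open>y\<close>\<close>

text \<open>The scale \<open>K * d\<close> depends on the offending point \<open>x\<close> and may
  be arbitrarily small; the uniformity of \<open>\<rho>y\<close> over centres near \<open>y\<close>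
  supplies a line at that centre and scale.\<close>

lemma approximable_subset_lipschitz_graph:
  fixes R :: "real^2 \<Rightarrow> real^2"
  assumes fwa: "fine_weak_approx_local 1 A" and "y \<in> A"
    and lip: "C-lipschitz_on UNIV u"
    and R: "orthogonal_transformation R"
    and y\<Sigma>: "R y \<in> graph_of u" and "\<rho>\<^sub>1 > 0"
    and dense: "R -` graph_of u \<inter> ball y \<rho>\<^sub>1 \<subseteq> closure A"
  shows "\<exists>r>0. A \<inter> ball y r \<subseteq> R -` graph_of u"
proof -
  have C0: "C \<ge> 0" using lip by (rule lipschitz_on_nonneg)
  have lipu: "\<bar>u s - u t\<bar> \<le> C * \<bar>s - t\<bar>" for s t
    using lipschitz_onD[OF lip, of s t] by (simp add: dist_real_def)
  have Rinner: "R v \<bullet> R w = v \<bullet> w" for v w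
    using R by (simp add: orthogonal_transformation_def)
  note Rnorm = orthogonal_transformation_norm[OF R] and Rdiff = orthogonal_transformation_norm_diff[OF R]
  have "surj R" using R by (rule orthogonal_transformation_surj)
  \<comment> \<open>Graph points at horizontal offset at most \<open>d\<close> lie within
    \<open>(2 + C) * d\<close> of \<open>x\<close>, hence strictly within
    \<open>K * d\<close>.\<close>
  define K where "K = 3 + C"
  \<comment> \<open>Chosen so that the constant \<open>3 + 2 * C\<close> of
    \<open>vertical_gap_le\<close>, the closure factor 2 and the scale factor \<open>K\<close>
    multiply with \<delta> to 1/2.\<close>
  define \<delta> where "\<delta> = 1 / (4 * K * (3 + 2 * C))"
  have K: "K \<ge> 3" and \<delta>0: "\<delta> > 0" using C0 by (auto simp: K_def \<delta>_def)
  have \<delta>: "(3 + 2 * C) * (2 * (\<delta> * K)) = 1 / 2" 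
  proof -
    have "3 + 2 * C > 0" using C0 by simp
    then show ?thesis using K by (simp add: \<delta>_def divide_simps)
  qed
  obtain \<rho>y where \<rho>y: "\<rho>y > 0" and app: "\<And>\<rho> x. 0 < \<rho> \<Longrightarrow> \<rho> \<le> \<rho>y \<Longrightarrow> x \<in> ball y \<rho>y \<Longrightarrow>
      \<exists>L. affine L \<and> aff_dim L = 1 \<and> ball x \<rho> \<inter> A \<subseteq> neighbourhood L (\<delta> * \<rho>)"
    using fwa \<delta>0 \<open>y \<in> A\<close> unfolding fine_weak_approx_local_def
    by (metis greaterThanAtMost_iff of_nat_1)
  \<comment> \<open>Since \<open>d \<le> (1 + C) * r\<close>, dividing by \<open>K\<^sup>2\<close>
    leaves room for \<open>K * d + 2 * r\<close> below both radii.\<close>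
  define r where "r = min \<rho>y \<rho>\<^sub>1 / K\<^sup>2"
  have r0: "r > 0" using \<rho>y \<open>\<rho>\<^sub>1 > 0\<close> K by (simp add: r_def)
  have rK: "r * K\<^sup>2 \<le> \<rho>y" "r * K\<^sup>2 \<le> \<rho>\<^sub>1" using K by (auto simp: r_def)
  have rexp: "r * K\<^sup>2 = K * ((1 + C) * r) + 2 * (K * r)"
    by (simp add: K_def power2_eq_square algebra_simps)
  have rle: "r < K * r" using K r0 by simp
  have "x \<in> R -` graph_of u" if x: "x \<in> A" "x \<in> ball y r" for x
  proof (rule ccontr)
    assume nin: "x \<notin> R -` graph_of u"
    define a where "a = R x $ 1"
    define d where "d = \<bar>R x $ 2 - u a\<bar>"
    have d0: "d > 0" using nin by (auto simp: mem_graph_of d_def a_def)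
    have yx: "norm (x - y) < r" using x by (simp add: dist_norm norm_minus_commute)
    have comp: "\<bar>R x $ i - R y $ i\<bar> < r" for i
      using component_le_norm_cart[of "R x - R y" i] yx by (simp add: Rdiff)
    \<comment> \<open>The gap vanishes at \<open>y\<close>, which lies on the graph, and each
      coordinate changes by less than \<open>r\<close> on the way to \<open>x\<close>.\<close>
    have "\<bar>u (R y $ 1) - u a\<bar> \<le> C * r"
      using lipu[of "R y $ 1" a] comp[of 1] C0
      by (smt (verit) a_def mult_left_mono)
    then have d_le: "d \<le> (1 + C) * r"
      using comp[of 2] y\<Sigma> by (simp add: d_def mem_graph_of algebra_simps)
    define \<rho> where "\<rho> = K * d"
    have \<rho>0: "\<rho> > 0" using K d0 by (simp add: \<rho>_def)
    have "\<rho> \<le> K * ((1 + C) * r)" unfolding \<rho>_def using d_le K by (intro mult_left_mono) auto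
    then have \<rho>_le: "\<rho> + 2 * r < r * K\<^sup>2" using rexp rle by linarith
    have "r < \<rho>y" "\<rho> \<le> \<rho>y" using \<rho>_le rK \<rho>0 r0 by linarith+
    then have "x \<in> ball y \<rho>y" using x by auto
    then obtain L where L: "affine L" "aff_dim L = 1" "ball x \<rho> \<inter> A \<subseteq> neighbourhood L (\<delta> * \<rho>)"
      using app[OF \<rho>0 \<open>\<rho> \<le> \<rho>y\<close>] by blast
    obtain n c where n: "n \<noteq> 0" "L = {x. n \<bullet> x = c}"
      using L(1,2) by (rule aff_dim_1_hyperplane)
    \<comment> \<open>Transporting the normal instead of the line gives
      \<open>n \<bullet> z = m \<bullet> R z\<close>, so \<open>A\<close> and \<open>L\<close> need
      not be rotated.\<close>
    define m where "m = R n"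
    have m: "norm m > 0" using n by (simp add: m_def Rnorm)
    define \<eta> where "\<eta> = norm m * (2 * (\<delta> * \<rho>))"
    have near: "\<bar>m \<bullet> R p - c\<bar> \<le> \<eta>" if p: "p \<in> closure A" "p \<in> ball x \<rho>" for p
    proof -
      obtain z where z: "n \<bullet> z = c" "norm (p - z) < 2 * (\<delta> * \<rho>)"
        using closure_in_neighbourhood[OF L(3) p] \<delta>0 \<rho>0 n(2) by auto
      have "\<bar>m \<bullet> R p - c\<bar> = \<bar>n \<bullet> (p - z)\<bar>" using z by (simp add: m_def Rinner inner_diff_right)
      also have "\<dots> \<le> norm n * norm (p - z)" by (rule Cauchy_Schwarz_ineq2)
      also have "\<dots> \<le> \<eta>" unfolding \<eta>_def m_def Rnorm using z by (intro mult_left_mono) auto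
      finally show ?thesis .
    qed
    have graph_near: "\<bar>m \<bullet> vector [t, u t] - c\<bar> \<le> \<eta>" if t: "\<bar>t - a\<bar> \<le> d" for t
    proof -
      obtain p where p: "R p = vector [t, u t]" using \<open>surj R\<close> by (metis surjD)
      have "norm (p - x) \<le> \<bar>t - a\<bar> + \<bar>u t - R x $ 2\<bar>"
        using norm_real_2_le[of "R p - R x"] unfolding Rdiff by (simp add: p a_def)
      also have "\<dots> \<le> d + (C * d + d)"
        using t lipu[of t a] mult_left_mono[OF t C0] unfolding d_def by linarith
      also have "\<dots> < \<rho>" using d0 by (simp add: \<rho>_def K_def algebra_simps)
      finally have px: "norm (p - x) < \<rho>" .
      have "norm (p - y) < \<rho> + r" using norm_triangle_ineq[of "p - x" "x - y"] px yx by simp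
      also have "\<dots> \<le> \<rho>\<^sub>1" using \<rho>_le rK r0 by linarith
      finally have "p \<in> ball y \<rho>\<^sub>1" by (simp add: dist_norm norm_minus_commute)
      moreover have "R p \<in> graph_of u" by (simp add: mem_graph_of p)
      ultimately have "p \<in> closure A" using dense by auto
      then show ?thesis using near[of p] px p by (simp add: dist_norm norm_minus_commute)
    qed
    have "\<bar>m \<bullet> R x - c\<bar> \<le> \<eta>" using x \<rho>0 by (intro near closure_subset[THEN subsetD]) auto
    moreover have "\<bar>u (a + d) - u (a - d)\<bar> \<le> C * (2 * d)"
      using lipu[of "a + d" "a - d"] d0 by simp
    \<comment> \<open>The three graph points have first coordinates \<open>a\<close>,
      \<open>a - d\<close> and \<open>a + d\<close>. By the choice of \<delta> the bound is half of
      the left side, which is positive.\<close>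
    ultimately have "d * norm m \<le> (3 + 2 * C) * \<eta>"
      using d0 C0
      by (intro vertical_gap_le[of m "R x" c \<eta> "vector [a, u a]" "vector [a - d, u (a - d)]"
            "vector [a + d, u (a + d)]"] graph_near) (auto simp: a_def d_def)
    also have "\<dots> = ((3 + 2 * C) * (2 * (\<delta> * K))) * (d * norm m)" by (simp add: \<eta>_def \<rho>_def)
    also have "\<dots> = d * norm m / 2" by (subst \<delta>) simp
    finally show False using d0 m by simp
  qed
  then show ?thesis using r0 by blast
qed

section \<open>Finite length of the graph and the contradiction\<close>

text \<open>On the ball the first rotated coordinate stays within \<open>r\<close> of that of
  \<open>y\<close>, so this piece lies in the image of an interval under the Lipschitz map
  \<open>f\<close> that pulls the graph parametrisation back by \<open>R\<close>.\<close>

lemma hausdorff1_lipschitz_graph_ball: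
  fixes R :: "real^2 \<Rightarrow> real^2"
  assumes lip: "C-lipschitz_on UNIV u" and R: "orthogonal_transformation R" and "r > 0"
  shows "hausdorff1 (R -` graph_of u \<inter> ball y r) < \<infinity>"
proof -
  note Rdiff = orthogonal_transformation_norm_diff[OF R]
  have "inj R" and "surj R"
    using R by (simp_all add: orthogonal_transformation_inj orthogonal_transformation_surj)
  define f where "f t = inv R (vector [t, u t])" for t
  have Rf: "R (f t) = vector [t, u t]" for t using \<open>surj R\<close> by (simp add: f_def surj_f_inv_f)
  define a b where "a = R y $ 1 - r" and "b = R y $ 1 + r"
  have "(1 + C)-lipschitz_on {a..b} f"
  proof (rule lipschitz_onI)
    fix s t
    have "norm (f s - f t) \<le> \<bar>s - t\<bar> + \<bar>u s - u t\<bar>"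
      using norm_real_2_le[of "R (f s) - R (f t)"] unfolding Rdiff by (simp add: Rf)
    also have "\<bar>u s - u t\<bar> \<le> C * \<bar>s - t\<bar>"
      using lipschitz_onD[OF lip, of s t] by (simp add: dist_real_def)
    finally show "dist (f s) (f t) \<le> (1 + C) * dist s t"
      by (simp add: dist_norm algebra_simps)
  qed (use lipschitz_on_nonneg[OF lip] in simp)
  then have "hausdorff1 (f ` {a..b}) \<le> ennreal ((1 + C) * (b - a))"
    using \<open>r > 0\<close> by (intro hausdorff1_lipschitz_image) (auto simp: a_def b_def)
  moreover have "R -` graph_of u \<inter> ball y r \<subseteq> f ` {a..b}"
  proof
    fix x assume x: "x \<in> R -` graph_of u \<inter> ball y r"
    then have "R x = R (f (R x $ 1))"
      by (metis vector_2_components Rf mem_graph_of IntD1 vimageD)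
    then have "x = f (R x $ 1)" using \<open>inj R\<close> by (simp add: inj_eq)
    moreover have "\<bar>R x $ 1 - R y $ 1\<bar> < r"
      using component_le_norm_cart[of "R x - R y" 1] x
      by (simp add: Rdiff dist_norm norm_minus_commute)
    then have "R x $ 1 \<in> {a..b}" by (auto simp: a_def b_def)
    ultimately show "x \<in> f ` {a..b}" by blast
  qed
  ultimately show ?thesis
    using hausdorff1_mono ennreal_less_top infinity_ennreal_def by (metis le_less_trans)
qed

theorem theorem4p1:
  fixes A \<Sigma> G :: "(real^2) set" and y :: "real^2" and \<rho>\<^sub>1 :: real
    and u :: "real \<Rightarrow> real" and R :: "real^2 \<Rightarrow> real^2"
  assumes "y \<in> A"
    and "\<forall>\<rho>>0. hausdorff1 (A \<inter> ball y \<rho>) = \<infinity>"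
    and "\<rho>\<^sub>1 > 0"
    and "\<exists>C. C-lipschitz_on UNIV u"
    and "subspace G" and "dim G = 1"
    and "linear R" and "rotation_matrix (matrix R)"
    and "R ` G = {vector [x, 0] | x. True}"
    and "\<Sigma> = R -` graph_of u"
    and "y \<in> \<Sigma> \<inter> ball y \<rho>\<^sub>1"
    and "closure (ball y \<rho>\<^sub>1 \<inter> A \<inter> \<Sigma>) = closure (\<Sigma> \<inter> ball y \<rho>\<^sub>1)"
  shows "\<not> fine_weak_approx_local 1 A"
proof
  assume "fine_weak_approx_local 1 A"
  moreover obtain C where lip: "C-lipschitz_on UNIV u" using assms(4) by blast
  moreover have R: "orthogonal_transformation R"
    using assms(7,8) by (simp add: orthogonal_transformation_matrix rotation_matrix_def)
  \<comment> \<open>The closure hypothesis enters here: every point of \<Sigma> in the ball is a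
    limit of points of \<open>A\<close>.\<close>
  moreover have "R -` graph_of u \<inter> ball y \<rho>\<^sub>1 \<subseteq> closure A"
  proof -
    have "R -` graph_of u \<inter> ball y \<rho>\<^sub>1 \<subseteq> closure (ball y \<rho>\<^sub>1 \<inter> A \<inter> \<Sigma>)"
      using closure_subset[of "\<Sigma> \<inter> ball y \<rho>\<^sub>1"] unfolding assms(12) by (simp add: assms(10))
    also have "\<dots> \<subseteq> closure A" by (rule closure_mono) auto
    finally show ?thesis .
  qed
  ultimately obtain r where r: "r > 0" "A \<inter> ball y r \<subseteq> R -` graph_of u"
    using approximable_subset_lipschitz_graph[of A y C u R \<rho>\<^sub>1] assms(1,3,10,11) by auto
  then have "hausdorff1 (A \<inter> ball y r) \<le> hausdorff1 (R -` graph_of u \<inter> ball y r)"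
    by (intro hausdorff1_mono) auto
  also have "\<dots> < \<infinity>" using lip R r(1) by (rule hausdorff1_lipschitz_graph_ball)
  finally show False using assms(2) r(1) by simp
qed

end
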